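(* The Lie algebra $\mathfrak{conf}(\mathbb H_3)$ of conformal sub-Riemannian vector fields of the Heisenberg group is eight-dimensional, and a complete set of generators (a basis) is given by the following vector fields, where for each of them the corresponding function $\eta$ is, up to a constant factor, the one indicated: \begin{align*} (\eta=0)\quad & F_1=\partial_z,\quad F_2=\partial_x+\tfrac y2\partial_z,\quad F_3=\partial_y-\tfrac x2\partial_z,\quad F_4=x\partial_y-y\partial_x,\\ (\eta=\text{const})\quad & F_5=-2z\,\partial_z-x\,\partial_x-y\,\partial_y,\\ (\eta=x)\quad & F_6=\tfrac12(3y^2-x^2)\partial_x+2(z-xy)\partial_y+\Big(-xz-\tfrac{x^2y}{4}-\tfrac{y^3}{4}\Big)\partial_z,\\ (\eta=y)\quad & F_7=-2(z+xy)\partial_x+\tfrac12(3x^2-y^2)\partial_y+\Big(-yz+\tfrac{x^3}{4}+\tfrac{xy^2}{4}\Big)\partial_z,\\ (\eta=z)\quad & F_8=\Big(-xz-\tfrac{x^2y}{4}-\tfrac{y^3}{4}\Big)\partial_x+\Big(-yz+\tfrac{xy^2}{4}+\tfrac{x^3}{4}\Big)\partial_y+\Big(-z^2+\tfrac1{16}(x^2+y^2)^2\Big)\partial_z . \end{align*}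
   Context: The Heisenberg group $\mathbb H_3$ is $\mathbb R^3$ with the sub-Riemannian structure whose distribution $\Delta$ has orthonormal frame $f_1=\partial_y+\frac x2\partial_z$, $f_2=\partial_x-\frac y2\partial_z$. For a vector field $Y$, let $Y^*\in C^\infty(T^*\mathbb R^3)$ be $Y^*(\lambda)=\langle\lambda,Y(\pi(\lambda))\rangle$; let $h_i=f_i^*$ and let $h=\frac12(h_1^2+h_2^2)$ be the sub-Riemannian Hamiltonian. The Poisson bracket on $T^*\mathbb R^3$ satisfies $\{Y^*,Z^*\}=[Y,Z]^*$ and $\{Y^*,\pi^*a\}=\pi^*(Y(a))$ for smooth functions $a$ on the base. A vector field $X$ is an (infinitesimal) conformal sub-Riemannian vector field if its flow preserves the conformal class of $h$, equivalently if $\{X^*,h\}=2\eta h$ for some smooth function $\eta$ on the base (pulled back to $T^*\mathbb R^3$). *)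

theory Defs
  imports "HOL-Analysis.Analysis" "HOL-Library.Function_Algebras"
begin

text \<open>Pointwise scaling, so that \<^const>\<open>span\<close>, \<^const>\<open>independent\<close>, \<^const>\<open>dim\<close> over
  the reals apply to vector fields. Spaces of vector fields are infinite-dimensional in general;
  \<^const>\<open>dim\<close> is \<open>0\<close> on sets without a finite spanning set.\<close>

instantiation "fun" :: (type, real_vector) real_vector
begin

definition scaleR_fun :: "real \<Rightarrow> ('a \<Rightarrow> 'b) \<Rightarrow> 'a \<Rightarrow> 'b"
  where "scaleR_fun c f = (\<lambda>x. c *\<^sub>R f x)"

instance
  by standard (simp_all add: scaleR_fun_def fun_eq_iff scaleR_add_right scaleR_add_left)

end

primrec continuously_differentiable ::
    "nat \<Rightarrow> ('a::euclidean_space \<Rightarrow> 'b::real_normed_vector) \<Rightarrow> bool" where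
  "continuously_differentiable 0 f \<longleftrightarrow> continuous_on UNIV f"
| "continuously_differentiable (Suc k) f \<longleftrightarrow>
     (\<forall>x. f differentiable (at x)) \<and>
     (\<forall>v. continuously_differentiable k (\<lambda>x. frechet_derivative f (at x) v))"

definition smooth :: "('a::euclidean_space \<Rightarrow> 'b::real_normed_vector) \<Rightarrow> bool" where
  "smooth f \<longleftrightarrow> (\<forall>k. continuously_differentiable k f)"

text \<open>A vector field on \<open>\<real>\<^sup>3\<close> is a map to coefficient vectors with respect to the frame
  \<open>\<partial>\<^sub>x, \<partial>\<^sub>y, \<partial>\<^sub>z\<close>; the coordinates \<open>x, y, z\<close> of a point \<open>q\<close> are
  \<open>q $ 1, q $ 2, q $ 3\<close>.\<close>

type_synonym field3 = "real^3 \<Rightarrow> real^3"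

definition lie_bracket :: "field3 \<Rightarrow> field3 \<Rightarrow> field3" where
  "lie_bracket Y Z =
     (\<lambda>q. frechet_derivative Z (at q) (Y q) - frechet_derivative Y (at q) (Z q))"

text \<open>The Jacobi identity and antisymmetry need not be required: they hold for the bracket of
  smooth vector fields.\<close>

definition lie_algebra_of_fields :: "field3 set \<Rightarrow> bool" where
  "lie_algebra_of_fields L \<longleftrightarrow>
     (\<forall>X\<in>L. smooth X) \<and> subspace L \<and> (\<forall>X\<in>L. \<forall>Y\<in>L. lie_bracket X Y \<in> L)"

text \<open>A point of \<open>T\<^sup>*\<real>\<^sup>3\<close> is a pair \<open>(q, p)\<close> of a base point and the coordinates of a covector
  in the dual coframe \<open>dx, dy, dz\<close>, so that the pairing with a tangent vector is the dot
  product.\<close>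

type_synonym cotangent3 = "(real^3) \<times> (real^3)"

definition lift :: "field3 \<Rightarrow> cotangent3 \<Rightarrow> real" where
  "lift Y = (\<lambda>(q, p). p \<bullet> Y q)"

definition pullback :: "(real^3 \<Rightarrow> real) \<Rightarrow> cotangent3 \<Rightarrow> real" where
  "pullback a = (\<lambda>(q, p). a q)"

text \<open>The overall sign is the one for which \<open>{Y\<^sup>*, Z\<^sup>*} = [Y, Z]\<^sup>*\<close> and
  \<open>{Y\<^sup>*, \<pi>\<^sup>*a} = \<pi>\<^sup>*(Y a)\<close>; see the two lemmas below.\<close>

definition poisson :: "(cotangent3 \<Rightarrow> real) \<Rightarrow> (cotangent3 \<Rightarrow> real) \<Rightarrow> cotangent3 \<Rightarrow> real" where
  "poisson F G = (\<lambda>l. \<Sum>i\<in>UNIV.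
     frechet_derivative F (at l) (0, axis i 1) * frechet_derivative G (at l) (axis i 1, 0)
   - frechet_derivative F (at l) (axis i 1, 0) * frechet_derivative G (at l) (0, axis i 1))"

lemma frechet_derivative_lift:
  assumes "Y differentiable (at q)"
  shows "frechet_derivative (lift Y) (at (q, p)) =
    (\<lambda>(u, w). w \<bullet> Y q + p \<bullet> frechet_derivative Y (at q) u)"
proof -
  have Y: "(Y has_derivative frechet_derivative Y (at q)) (at (fst (q, p)))"
    using assms by (simp add: frechet_derivative_works[symmetric])
  have "((\<lambda>l. Y (fst l)) has_derivative (\<lambda>l. frechet_derivative Y (at q) (fst l))) (at (q, p))"
    by (rule has_derivative_compose[where f = fst and f' = fst, OF _ Y]) (simp add: bounded_linear_imp_has_derivative bounded_linear_fst)
  then have "((\<lambda>l. snd l \<bullet> Y (fst l)) has_derivative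
      (\<lambda>l. snd (q, p) \<bullet> frechet_derivative Y (at q) (fst l) + snd l \<bullet> Y (fst (q, p)))) (at (q, p))"
    by (intro has_derivative_inner) (intro derivative_eq_intros, auto)
  then have "(lift Y has_derivative (\<lambda>(u, w). w \<bullet> Y q + p \<bullet> frechet_derivative Y (at q) u))
      (at (q, p))"
    by (simp add: lift_def case_prod_unfold add.commute)
  then show ?thesis
    by (rule frechet_derivative_at[symmetric])
qed

lemma frechet_derivative_pullback:
  assumes "a differentiable (at q)"
  shows "frechet_derivative (pullback a) (at (q, p)) = (\<lambda>(u, w). frechet_derivative a (at q) u)"
proof -
  have a: "(a has_derivative frechet_derivative a (at q)) (at (fst (q, p)))"
    using assms by (simp add: frechet_derivative_works[symmetric])
  have "((\<lambda>l. a (fst l)) has_derivative (\<lambda>l. frechet_derivative a (at q) (fst l))) (at (q, p))"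
    by (rule has_derivative_compose[where f = fst and f' = fst, OF _ a]) (simp add: bounded_linear_imp_has_derivative bounded_linear_fst)
  then have "(pullback a has_derivative (\<lambda>(u, w). frechet_derivative a (at q) u)) (at (q, p))"
    by (simp add: pullback_def case_prod_unfold)
  then show ?thesis
    by (rule frechet_derivative_at[symmetric])
qed

lemma linear_sum_axis:
  fixes f :: "real^3 \<Rightarrow> 'b::real_vector"
  assumes "linear f"
  shows "(\<Sum>i\<in>UNIV. v $ i *\<^sub>R f (axis i 1)) = f v"
proof -
  have "f v = f (\<Sum>i\<in>UNIV. v $ i *\<^sub>R axis i 1)"
    by (subst basis_expansion[of v, unfolded scalar_mult_eq_scaleR, symmetric]) simp
  also have "\<dots> = (\<Sum>i\<in>UNIV. v $ i *\<^sub>R f (axis i 1))"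
    using assms by (simp add: linear_sum linear_cmul)
  finally show ?thesis by simp
qed

lemma poisson_lift_lift:
  assumes "Y differentiable (at q)" "Z differentiable (at q)"
  shows "poisson (lift Y) (lift Z) (q, p) = lift (lie_bracket Y Z) (q, p)"
proof -
  have "linear (frechet_derivative Y (at q))" "linear (frechet_derivative Z (at q))"
    using assms by (simp_all add: linear_frechet_derivative)
  then have l: "(\<Sum>i\<in>UNIV. v $ i *\<^sub>R frechet_derivative Y (at q) (axis i 1)) = frechet_derivative Y (at q) v"
      "(\<Sum>i\<in>UNIV. v $ i *\<^sub>R frechet_derivative Z (at q) (axis i 1)) = frechet_derivative Z (at q) v" for v
    by (auto simp only: linear_sum_axis)
  have z: "frechet_derivative Y (at q) 0 = 0" "frechet_derivative Z (at q) 0 = 0"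
    using assms by (simp_all add: linear_frechet_derivative linear_0)
  have "poisson (lift Y) (lift Z) (q, p)
      = p \<bullet> (\<Sum>i\<in>UNIV. Y q $ i *\<^sub>R frechet_derivative Z (at q) (axis i 1))
      - p \<bullet> (\<Sum>i\<in>UNIV. Z q $ i *\<^sub>R frechet_derivative Y (at q) (axis i 1))"
    using assms by (simp add: poisson_def frechet_derivative_lift z inner_axis' inner_sum_right
        sum_subtractf mult.commute)
  then show ?thesis
    by (simp add: l lift_def lie_bracket_def inner_diff_right)
qed

lemma poisson_lift_pullback:
  assumes "Y differentiable (at q)" "a differentiable (at q)"
  shows "poisson (lift Y) (pullback a) (q, p) = frechet_derivative a (at q) (Y q)"
proof -
  have "linear (frechet_derivative Y (at q))" "linear (frechet_derivative a (at q))"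
    using assms by (simp_all add: linear_frechet_derivative)
  then have "frechet_derivative Y (at q) 0 = 0" "frechet_derivative a (at q) 0 = 0"
    and l: "(\<Sum>i\<in>UNIV. Y q $ i *\<^sub>R frechet_derivative a (at q) (axis i 1)) = frechet_derivative a (at q) (Y q)"
    by (auto simp only: linear_0 linear_sum_axis)
  then have "poisson (lift Y) (pullback a) (q, p)
      = (\<Sum>i\<in>UNIV. Y q $ i *\<^sub>R frechet_derivative a (at q) (axis i 1))"
    using assms by (simp add: poisson_def frechet_derivative_lift frechet_derivative_pullback inner_axis')
  with l show ?thesis by simp
qed

definition heis_f1 :: field3 where
  "heis_f1 q = vector [0, 1, q$1 / 2]"

definition heis_f2 :: field3 where
  "heis_f2 q = vector [1, 0, - q$2 / 2]"

definition heis_hamiltonian :: "cotangent3 \<Rightarrow> real" where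
  "heis_hamiltonian l = ((lift heis_f1 l)\<^sup>2 + (lift heis_f2 l)\<^sup>2) / 2"

text \<open>The infinitesimal form, \<open>{X\<^sup>*, h} = 2 (\<pi>\<^sup>*\<eta>) h\<close>, of the condition that the
  (local) flow of \<open>X\<close> preserves the conformal class of \<open>h\<close>.\<close>

definition conformal_factor :: "field3 \<Rightarrow> (real^3 \<Rightarrow> real) \<Rightarrow> bool" where
  "conformal_factor X \<eta> \<longleftrightarrow>
     smooth \<eta> \<and> (\<forall>l. poisson (lift X) heis_hamiltonian l = 2 * pullback \<eta> l * heis_hamiltonian l)"

definition conf_H3 :: "field3 set" where
  "conf_H3 = {X. smooth X \<and> (\<exists>\<eta>. conformal_factor X \<eta>)}"

definition F1 :: field3 where
  "F1 q = vector [0, 0, 1]"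

definition F2 :: field3 where
  "F2 q = (let y = q$2 in vector [1, 0, y / 2])"

definition F3 :: field3 where
  "F3 q = (let x = q$1 in vector [0, 1, - x / 2])"

definition F4 :: field3 where
  "F4 q = (let x = q$1; y = q$2 in vector [- y, x, 0])"

definition F5 :: field3 where
  "F5 q = (let x = q$1; y = q$2; z = q$3 in vector [- x, - y, - 2 * z])"

definition F6 :: field3 where
  "F6 q = (let x = q$1; y = q$2; z = q$3 in vector
     [(3 * y^2 - x^2) / 2,
      2 * (z - x * y),
      - x * z - x^2 * y / 4 - y^3 / 4])"

definition F7 :: field3 where
  "F7 q = (let x = q$1; y = q$2; z = q$3 in vector
     [- 2 * (z + x * y),
      (3 * x^2 - y^2) / 2,
      - y * z + x^3 / 4 + x * y^2 / 4])"

definition F8 :: field3 where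
  "F8 q = (let x = q$1; y = q$2; z = q$3 in vector
     [- x * z - x^2 * y / 4 - y^3 / 4,
      - y * z + x * y^2 / 4 + x^3 / 4,
      - (z^2) + (x^2 + y^2)^2 / 16])"

end

theory Submission
  imports Defs
begin

text \<open>
Write \<open>T = \<partial>\<^sub>x - y/2 \<partial>\<^sub>z\<close> and \<open>S = \<partial>\<^sub>y + x/2 \<partial>\<^sub>z\<close> for the frame, so that \<open>[T, S] = \<partial>\<^sub>z\<close> (the
field \<^const>\<open>F1\<close>), which commutes with both. Since the Hamiltonian is half the sum of the squares of the
lifts of \<open>S\<close> and \<open>T\<close>, the equation for its Poisson bracket says, fibre by fibre, that bracketing with
\<open>X\<close> acts on the frame as an infinitesimal similarity: \<open>[X, T] = \<eta> T - \<mu> S\<close> and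
\<open>[X, S] = \<mu> T + \<eta> S\<close> for a function \<open>\<mu>\<close> (lemma \<open>conformal_factor_iff_lie_bracket\<close>). In this form
the Jacobi identity shows at once that conformal fields are closed under brackets.

In components the condition is an overdetermined linear system. With \<open>a, b\<close> the first two
components of \<open>X\<close> and \<open>c\<close> its value under the contact form \<open>dz + y/2 dx - x/2 dy\<close>, it reads
\<open>T a = S b = -\<eta>\<close>, \<open>S a = -T b\<close>, \<open>T c = -b\<close>, \<open>S c = a\<close> (lemma \<open>conformal_factor_iff_contact\<close>).
Commuting derivatives prolongs it to a closed first order system for \<open>a, b, c\<close>, \<open>\<mu> = T b\<close>, \<open>\<eta>\<close>
and the three derivatives of \<open>\<eta>\<close> along \<open>T\<close>, \<open>S\<close>, \<open>\<partial>\<^sub>z\<close>, in which the last of them, \<open>\<partial>\<^sub>z \<eta>\<close>, is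
constant (lemma \<open>conformal_prolongation\<close>). A function killed by \<open>T\<close> and \<open>S\<close> is also killed by their
bracket, hence constant. Therefore the eight numbers \<open>X(0)\<close>, \<open>\<mu>(0)\<close>, \<open>\<eta>(0)\<close>, \<open>d\<eta>(0)\<close> determine \<open>X\<close>
(lemma \<open>conformal_field_determined_by_jet\<close>), and the dimension is at most eight.

Each of the eight given fields is conformal and makes exactly one of these numbers nonzero. So
subtracting the evident combination of them from a conformal field leaves a field with vanishing jet,
that is zero. A vanishing combination is trivial because its conformal factor and its values at the
origin and at one more point vanish.
\<close>

section \<open>Smooth functions\<close>

text \<open>In the product rule the undifferentiated factors occur next to derivatives, so the induction on
the order needs regularity to be monotone in the order.\<close>

lemma continuously_differentiable_SucD:
  "continuously_differentiable (Suc k) f \<Longrightarrow> continuously_differentiable k f"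
proof (induction k arbitrary: f)
  case 0
  then show ?case
    by (auto simp: differentiable_imp_continuous_on differentiable_on_def
        intro: differentiable_at_withinI)
next
  case (Suc k)
  then show ?case by (metis continuously_differentiable.simps(2))
qed

lemma continuously_differentiable_const: "continuously_differentiable k (\<lambda>x. c)"
  by (induction k arbitrary: c) simp_all

lemma continuously_differentiable_add:
  "continuously_differentiable k f \<Longrightarrow> continuously_differentiable k g \<Longrightarrow>
   continuously_differentiable k (\<lambda>x. f x + g x)"
proof (induction k arbitrary: f g)
  case 0
  then show ?case by (simp add: continuous_on_add)
next
  case (Suc k)
  have "frechet_derivative (\<lambda>x. f x + g x) (at x) v =
      frechet_derivative f (at x) v + frechet_derivative g (at x) v" for x v
    using Suc.prems
    by (subst frechet_derivative_at[symmetric])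
      (auto intro!: has_derivative_add simp: frechet_derivative_works)
  with Suc show ?case by auto
qed

lemma continuously_differentiable_bounded_linear:
  assumes "bounded_linear h"
  shows "continuously_differentiable k f \<Longrightarrow> continuously_differentiable k (\<lambda>x. h (f x))"
proof (induction k arbitrary: f)
  case 0
  then show ?case using assms by (simp add: bounded_linear.continuous_on)
next
  case (Suc k)
  have d: "((\<lambda>x. h (f x)) has_derivative (\<lambda>v. h (frechet_derivative f (at x) v))) (at x)" for x
    using Suc.prems assms
    by (auto intro: bounded_linear.has_derivative simp: frechet_derivative_works)
  then have "frechet_derivative (\<lambda>x. h (f x)) (at x) v = h (frechet_derivative f (at x) v)" for x v
    by (simp flip: frechet_derivative_at[OF d])
  with Suc differentiableI[OF d] show ?case by auto
qed

lemma continuously_differentiable_scaleR: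
  fixes f :: "'a::euclidean_space \<Rightarrow> real"
  shows "continuously_differentiable k f \<Longrightarrow> continuously_differentiable k g \<Longrightarrow>
    continuously_differentiable k (\<lambda>x. f x *\<^sub>R g x)"
proof (induction k arbitrary: f g)
  case 0
  then show ?case by (simp add: continuous_on_scaleR)
next
  case (Suc k)
  have d: "((\<lambda>x. f x *\<^sub>R g x) has_derivative
      (\<lambda>v. f x *\<^sub>R frechet_derivative g (at x) v + frechet_derivative f (at x) v *\<^sub>R g x)) (at x)" for x
    using Suc.prems by (auto intro!: has_derivative_scaleR simp: frechet_derivative_works)
  have "frechet_derivative (\<lambda>x. f x *\<^sub>R g x) (at x) v =
      f x *\<^sub>R frechet_derivative g (at x) v + frechet_derivative f (at x) v *\<^sub>R g x" for x v
    by (simp flip: frechet_derivative_at[OF d])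
  moreover have "continuously_differentiable k f" "continuously_differentiable k g"
    using Suc.prems by (auto intro: continuously_differentiable_SucD)
  ultimately show ?case
    using Suc differentiableI[OF d] by (auto intro!: continuously_differentiable_add)
qed

lemma smooth_differentiable: "smooth f \<Longrightarrow> f differentiable (at x)"
  unfolding smooth_def by (meson continuously_differentiable.simps(2))

lemma smooth_has_derivative:
  "smooth f \<Longrightarrow> (f has_derivative frechet_derivative f (at x)) (at x)"
  using smooth_differentiable frechet_derivative_works by blast

lemma smooth_continuous_on: "smooth f \<Longrightarrow> continuous_on UNIV f"
  unfolding smooth_def by (metis continuously_differentiable.simps(1))

lemma smooth_frechet_derivative:
  assumes "smooth f"
  shows "smooth (\<lambda>x. frechet_derivative f (at x) v)"
  unfolding smooth_def
proof
  fix k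
  have "continuously_differentiable (Suc k) f" using assms unfolding smooth_def ..
  then show "continuously_differentiable k (\<lambda>x. frechet_derivative f (at x) v)" by simp
qed

lemma smooth_const [simp]: "smooth (\<lambda>x. c)"
  by (simp add: smooth_def continuously_differentiable_const)

lemma smooth_add [simp]: "smooth f \<Longrightarrow> smooth g \<Longrightarrow> smooth (\<lambda>x. f x + g x)"
  by (simp add: smooth_def continuously_differentiable_add)

lemma smooth_bounded_linear: "bounded_linear h \<Longrightarrow> smooth f \<Longrightarrow> smooth (\<lambda>x. h (f x))"
  by (simp add: smooth_def continuously_differentiable_bounded_linear)

lemma smooth_scaleR [simp]: "smooth f \<Longrightarrow> smooth g \<Longrightarrow> smooth (\<lambda>x. f x *\<^sub>R g x)"
  by (simp add: smooth_def continuously_differentiable_scaleR)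

lemma smooth_mult [simp]:
  fixes f g :: "'a::euclidean_space \<Rightarrow> real"
  shows "smooth f \<Longrightarrow> smooth g \<Longrightarrow> smooth (\<lambda>x. f x * g x)"
  using smooth_scaleR[of f g] by simp

lemma smooth_uminus [simp]: "smooth f \<Longrightarrow> smooth (\<lambda>x. - f x)"
  by (rule smooth_bounded_linear) (auto intro: bounded_linear_minus bounded_linear_ident)

lemma smooth_diff [simp]: "smooth f \<Longrightarrow> smooth g \<Longrightarrow> smooth (\<lambda>x. f x - g x)"
  using smooth_add[of f "\<lambda>x. - g x"] by simp

lemma smooth_divide [simp]:
  fixes f :: "'a::euclidean_space \<Rightarrow> real"
  shows "smooth f \<Longrightarrow> smooth (\<lambda>x. f x / c)"
  using smooth_mult[of f "\<lambda>x. inverse c"] by (simp add: divide_inverse)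

lemma smooth_power [simp]:
  fixes f :: "'a::euclidean_space \<Rightarrow> real"
  shows "smooth f \<Longrightarrow> smooth (\<lambda>x. f x ^ n)"
  by (induction n) simp_all

lemma smooth_sum [simp]:
  "(\<And>i. i \<in> I \<Longrightarrow> smooth (f i)) \<Longrightarrow> smooth (\<lambda>x. \<Sum>i\<in>I. f i x)"
  by (induction I rule: infinite_finite_induct) simp_all

lemma smooth_ident [simp]: "smooth (\<lambda>x. x)"
proof -
  have "continuously_differentiable k (\<lambda>x::'a. x)" for k
    by (cases k) (simp_all add: continuously_differentiable_const)
  then show ?thesis by (simp add: smooth_def)
qed

lemma smooth_inner_left [simp]: "smooth f \<Longrightarrow> smooth (\<lambda>x. f x \<bullet> w)"
  by (rule smooth_bounded_linear) (rule bounded_linear_inner_left)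

lemma smooth_nth [simp]: "smooth f \<Longrightarrow> smooth (\<lambda>x. f x $ i)"
  by (rule smooth_bounded_linear) (rule bounded_linear_vec_nth)

lemma smooth_vec3I:
  fixes f :: "'a::euclidean_space \<Rightarrow> real^3"
  assumes "smooth (\<lambda>x. f x $ 1)" "smooth (\<lambda>x. f x $ 2)" "smooth (\<lambda>x. f x $ 3)"
  shows "smooth f"
proof -
  have "f = (\<lambda>x. \<Sum>i\<in>UNIV. (f x $ i) *\<^sub>R axis i 1)"
    using basis_expansion[where 'a=real and 'n=3] by (simp add: fun_eq_iff scalar_mult_eq_scaleR)
  moreover have "smooth (\<lambda>x. \<Sum>i\<in>UNIV. (f x $ i) *\<^sub>R (axis i 1 :: real^3))"
    using assms by (simp add: sum_3)
  ultimately show ?thesis by simp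
qed

section \<open>Symmetry of second derivatives\<close>

lemma smooth_has_derivative_on_line:
  fixes f :: "'a::euclidean_space \<Rightarrow> real"
  assumes "smooth f"
  shows "((\<lambda>s. f (x + s *\<^sub>R v)) has_real_derivative
    frechet_derivative f (at (x + s *\<^sub>R v)) v) (at s)"
proof -
  have "((\<lambda>s. x + s *\<^sub>R v) has_derivative (\<lambda>h. h *\<^sub>R v)) (at s)"
    by (auto intro!: derivative_eq_intros)
  from has_derivative_compose[OF this smooth_has_derivative[OF assms]]
  have "((\<lambda>s. f (x + s *\<^sub>R v)) has_derivative
      (\<lambda>h. frechet_derivative f (at (x + s *\<^sub>R v)) (h *\<^sub>R v))) (at s)" .
  moreover have "frechet_derivative f (at (x + s *\<^sub>R v)) (h *\<^sub>R v) =
      h * frechet_derivative f (at (x + s *\<^sub>R v)) v" for h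
    using linear_frechet_derivative[OF smooth_differentiable[OF assms]]
    by (simp add: linear_cmul)
  ultimately show ?thesis
    by (simp add: has_field_derivative_def mult_commute_abs)
qed

text \<open>The mean value theorem, applied first in direction \<open>v\<close> to the increment in direction \<open>w\<close> and then
to the resulting derivative. The left-hand side is symmetric in \<open>v\<close> and \<open>w\<close>, the right-hand side
is not: this is the source of the symmetry of second derivatives.\<close>

lemma second_difference_mean_value:
  fixes f :: "'a::euclidean_space \<Rightarrow> real"
  assumes f: "smooth f" and t: "0 < t"
  obtains y where "dist y x \<le> t * (norm v + norm w)"
    and "f (x + t *\<^sub>R v + t *\<^sub>R w) - f (x + t *\<^sub>R v) - f (x + t *\<^sub>R w) + f x =
      t\<^sup>2 * frechet_derivative (\<lambda>x. frechet_derivative f (at x) v) (at y) w"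
proof -
  let ?g = "\<lambda>x. frechet_derivative f (at x) v"
  let ?\<phi> = "\<lambda>s. f (x + t *\<^sub>R w + s *\<^sub>R v) - f (x + s *\<^sub>R v)"
  have "(?\<phi> has_real_derivative ?g (x + t *\<^sub>R w + s *\<^sub>R v) - ?g (x + s *\<^sub>R v)) (at s)" for s
    by (intro DERIV_diff smooth_has_derivative_on_line f)
  then obtain s where s: "0 < s" "s < t"
    and \<phi>: "?\<phi> t - ?\<phi> 0 = t * (?g (x + t *\<^sub>R w + s *\<^sub>R v) - ?g (x + s *\<^sub>R v))"
    using MVT2[OF t, of ?\<phi>] by force
  let ?\<psi> = "\<lambda>r. ?g (x + s *\<^sub>R v + r *\<^sub>R w)"
  have "(?\<psi> has_real_derivative frechet_derivative ?g (at (x + s *\<^sub>R v + r *\<^sub>R w)) w) (at r)" for r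
    by (intro smooth_has_derivative_on_line smooth_frechet_derivative f)
  then obtain r where r: "0 < r" "r < t"
    and \<psi>: "?\<psi> t - ?\<psi> 0 = t * frechet_derivative ?g (at (x + s *\<^sub>R v + r *\<^sub>R w)) w"
    using MVT2[OF t, of ?\<psi>] by force
  show thesis
  proof
    have "norm (s *\<^sub>R v + r *\<^sub>R w) \<le> s * norm v + r * norm w"
      using s r norm_triangle_ineq[of "s *\<^sub>R v" "r *\<^sub>R w"] by simp
    also have "\<dots> \<le> t * norm v + t * norm w"
      using s r by (intro add_mono mult_right_mono) auto
    finally show "dist (x + s *\<^sub>R v + r *\<^sub>R w) x \<le> t * (norm v + norm w)"
      by (simp add: dist_norm algebra_simps)
    show "f (x + t *\<^sub>R v + t *\<^sub>R w) - f (x + t *\<^sub>R v) - f (x + t *\<^sub>R w) + f x =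
        t\<^sup>2 * frechet_derivative ?g (at (x + s *\<^sub>R v + r *\<^sub>R w)) w"
      using \<phi> \<psi> by (simp add: algebra_simps power2_eq_square)
  qed
qed

text \<open>Both mixed derivatives, taken at two points close to \<open>x\<close>, equal the same second difference
quotient; let the step size tend to 0 and use continuity.\<close>

lemma second_derivative_symmetric_real:
  fixes f :: "'a::euclidean_space \<Rightarrow> real"
  assumes f: "smooth f"
  shows "frechet_derivative (\<lambda>x. frechet_derivative f (at x) v) (at x) w =
    frechet_derivative (\<lambda>x. frechet_derivative f (at x) w) (at x) v"
proof -
  let ?D = "\<lambda>v w y. frechet_derivative (\<lambda>x. frechet_derivative f (at x) v) (at y) w"
  have cont: "continuous (at x) (?D v w)" for v w
    using smooth_continuous_on[OF smooth_frechet_derivative[OF smooth_frechet_derivative[OF f]]]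
    by (simp add: continuous_on_eq_continuous_at)
  have "dist (?D v w x) (?D w v x) \<le> e" if e: "e > 0" for e
  proof -
    obtain d1 where d1: "d1 > 0" "\<And>y. dist y x < d1 \<Longrightarrow> dist (?D v w y) (?D v w x) < e / 2"
      using cont[of v w] e unfolding continuous_at_eps_delta by (meson half_gt_zero)
    obtain d2 where d2: "d2 > 0" "\<And>y. dist y x < d2 \<Longrightarrow> dist (?D w v y) (?D w v x) < e / 2"
      using cont[of w v] e unfolding continuous_at_eps_delta by (meson half_gt_zero)
    \<comment> \<open>The summand 1 makes the step positive and the distances below strictly small even if \<open>v = w = 0\<close>.\<close>
    define t where "t = min d1 d2 / (1 + norm v + norm w)"
    have n: "1 + norm v + norm w > 0" by (smt (verit) norm_ge_zero)
    then have t: "t > 0" using d1(1) d2(1) by (simp add: t_def)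
    have "t * (norm v + norm w) < t * (1 + norm v + norm w)" using t by simp
    also have "\<dots> = min d1 d2" using n by (simp add: t_def)
    finally have small: "t * (norm v + norm w) < d1" "t * (norm w + norm v) < d2"
      by (simp_all add: add.commute)
    obtain y where y: "dist y x \<le> t * (norm v + norm w)"
      "f (x + t *\<^sub>R v + t *\<^sub>R w) - f (x + t *\<^sub>R v) - f (x + t *\<^sub>R w) + f x = t\<^sup>2 * ?D v w y"
      by (rule second_difference_mean_value[OF f t])
    obtain y' where y': "dist y' x \<le> t * (norm w + norm v)"
      "f (x + t *\<^sub>R w + t *\<^sub>R v) - f (x + t *\<^sub>R w) - f (x + t *\<^sub>R v) + f x = t\<^sup>2 * ?D w v y'"
      by (rule second_difference_mean_value[OF f t])
    have "f (x + t *\<^sub>R w + t *\<^sub>R v) = f (x + t *\<^sub>R v + t *\<^sub>R w)"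
      by (simp add: add_ac)
    with y(2) y'(2) have "t\<^sup>2 * ?D v w y = t\<^sup>2 * ?D w v y'" by linarith
    then have eq: "?D v w y = ?D w v y'" using t by simp
    have "dist (?D v w y) (?D v w x) < e / 2"
      using y(1) small by (intro d1) linarith
    moreover have "dist (?D v w y) (?D w v x) < e / 2"
      unfolding eq using y'(1) small by (intro d2) linarith
    ultimately show ?thesis
      by (rule less_imp_le[OF dist_triangle_half_r])
  qed
  then have "dist (?D v w x) (?D w v x) \<le> 0"
    by (rule field_le_epsilon) simp
  then show ?thesis by simp
qed

lemma frechet_derivative_inner:
  fixes f :: "'a::euclidean_space \<Rightarrow> 'b::real_inner"
  assumes "smooth f"
  shows "frechet_derivative (\<lambda>x. f x \<bullet> w) (at x) v = frechet_derivative f (at x) v \<bullet> w"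
proof -
  have "((\<lambda>x. f x \<bullet> w) has_derivative (\<lambda>v. frechet_derivative f (at x) v \<bullet> w)) (at x)"
    by (intro has_derivative_inner_left smooth_has_derivative assms)
  then show ?thesis by (simp flip: frechet_derivative_at)
qed

lemma second_derivative_symmetric:
  fixes f :: "'a::euclidean_space \<Rightarrow> 'b::real_inner"
  assumes f: "smooth f"
  shows "frechet_derivative (\<lambda>x. frechet_derivative f (at x) v) (at x) w =
    frechet_derivative (\<lambda>x. frechet_derivative f (at x) w) (at x) v"
proof -
  have "frechet_derivative (\<lambda>x. frechet_derivative f (at x) v) (at x) w \<bullet> u =
      frechet_derivative (\<lambda>x. frechet_derivative f (at x) w) (at x) v \<bullet> u" for u
    using second_derivative_symmetric_real[OF smooth_inner_left[OF f], of u v x w] f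
    by (simp add: frechet_derivative_inner smooth_frechet_derivative)
  then show ?thesis by (metis vector_eq_rdot)
qed

section \<open>Vector fields as derivations\<close>

text \<open>The values may lie in any normed space: for vector-valued functions this allows to write the Lie
bracket itself with derivatives along fields, which reduces the Jacobi identity to the commutator
formula.\<close>

definition along :: "('a \<Rightarrow> 'a) \<Rightarrow> ('a::euclidean_space \<Rightarrow> 'b::real_normed_vector) \<Rightarrow> 'a \<Rightarrow> 'b" where
  "along X f = (\<lambda>q. frechet_derivative f (at q) (X q))"

lemma lie_bracket_eq_along: "lie_bracket X Y = (\<lambda>q. along X Y q - along Y X q)"
  by (simp add: lie_bracket_def along_def)

lemma along_eqI: "(f has_derivative f') (at q) \<Longrightarrow> along X f q = f' (X q)"
  unfolding along_def by (simp flip: frechet_derivative_at)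

lemma smooth_imp_linear_derivative: "smooth f \<Longrightarrow> linear (frechet_derivative f (at q))"
  by (simp add: linear_frechet_derivative smooth_differentiable)

lemma frechet_derivative_basis:
  assumes "smooth f"
  shows "frechet_derivative f (at q) v = (\<Sum>b\<in>Basis. (v \<bullet> b) *\<^sub>R frechet_derivative f (at q) b)"
proof -
  have "frechet_derivative f (at q) v = frechet_derivative f (at q) (\<Sum>b\<in>Basis. (v \<bullet> b) *\<^sub>R b)"
    by (simp add: euclidean_representation)
  also have "\<dots> = (\<Sum>b\<in>Basis. (v \<bullet> b) *\<^sub>R frechet_derivative f (at q) b)"
    using smooth_imp_linear_derivative[OF assms] by (simp add: linear_sum linear_cmul)
  finally show ?thesis .
qed

lemma smooth_along [simp]: "smooth X \<Longrightarrow> smooth f \<Longrightarrow> smooth (along X f)"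
  unfolding along_def
  by (subst frechet_derivative_basis) (auto intro!: smooth_sum smooth_scaleR smooth_frechet_derivative)

lemma smooth_lie_bracket [simp]: "smooth X \<Longrightarrow> smooth Y \<Longrightarrow> smooth (lie_bracket X Y)"
  by (simp add: lie_bracket_eq_along)

lemma along_const [simp]: "along X (\<lambda>x. c) = (\<lambda>x. 0)"
  by (simp add: along_def)

lemma along_add [simp]:
  "smooth f \<Longrightarrow> smooth g \<Longrightarrow> along X (\<lambda>x. f x + g x) q = along X f q + along X g q"
  by (subst along_eqI[OF has_derivative_add]) (auto intro: smooth_has_derivative simp: along_def)

lemma along_diff [simp]:
  "smooth f \<Longrightarrow> smooth g \<Longrightarrow> along X (\<lambda>x. f x - g x) q = along X f q - along X g q"
  by (subst along_eqI[OF has_derivative_diff]) (auto intro: smooth_has_derivative simp: along_def)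

lemma along_uminus [simp]: "smooth f \<Longrightarrow> along X (\<lambda>x. - f x) q = - along X f q"
  by (subst along_eqI[OF has_derivative_minus]) (auto intro: smooth_has_derivative simp: along_def)

lemma along_scaleR [simp]:
  "smooth f \<Longrightarrow> smooth g \<Longrightarrow>
    along X (\<lambda>x. f x *\<^sub>R g x) q = along X f q *\<^sub>R g q + f q *\<^sub>R along X g q"
  by (subst along_eqI[OF has_derivative_scaleR])
    (auto intro: smooth_has_derivative simp: along_def add.commute)

lemma along_mult [simp]:
  fixes f g :: "'a::euclidean_space \<Rightarrow> real"
  shows "smooth f \<Longrightarrow> smooth g \<Longrightarrow> along X (\<lambda>x. f x * g x) q = along X f q * g q + f q * along X g q"
  using along_scaleR[of f g] by simp

lemma along_divide [simp]:
  fixes f :: "'a::euclidean_space \<Rightarrow> real"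
  shows "smooth f \<Longrightarrow> along X (\<lambda>x. f x / c) q = along X f q / c"
  using along_mult[of f "\<lambda>x. inverse c"] by (simp add: divide_inverse)

lemma along_power [simp]:
  fixes f :: "'a::euclidean_space \<Rightarrow> real"
  assumes "smooth f"
  shows "along X (\<lambda>x. f x ^ n) q = real n * f q ^ (n - 1) * along X f q"
  by (subst along_eqI[OF has_derivative_power[OF smooth_has_derivative]])
    (simp_all add: assms along_def algebra_simps)

lemma along_nth: "smooth f \<Longrightarrow> along X (\<lambda>x. f x $ i) q = along X f q $ i"
  by (subst along_eqI[OF bounded_linear.has_derivative[OF bounded_linear_vec_nth]])
    (auto intro: smooth_has_derivative simp: along_def)

lemma along_coordinate [simp]: "along X (\<lambda>x. x $ i) q = X q $ i"
  by (simp add: along_nth) (simp add: along_def)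

text \<open>The second derivative along two fields splits into a first order term, which survives
antisymmetrization as the bracket, and a term symmetric in the two fields.\<close>

lemma along_along:
  assumes X: "smooth X" and Y: "smooth Y" and f: "smooth f"
  shows "along X (along Y f) q = frechet_derivative f (at q) (along X Y q) +
    (\<Sum>b\<in>Basis. \<Sum>c\<in>Basis. ((X q \<bullet> b) * (Y q \<bullet> c)) *\<^sub>R
       frechet_derivative (\<lambda>x. frechet_derivative f (at x) c) (at q) b)"
proof -
  let ?D = "\<lambda>c x. frechet_derivative f (at x) c"
  have D: "smooth (?D c)" for c by (simp add: smooth_frechet_derivative f)
  have "along Y f = (\<lambda>x. \<Sum>c\<in>Basis. (Y x \<bullet> c) *\<^sub>R ?D c x)"
    unfolding along_def using frechet_derivative_basis[OF f] by blast
  then have *: "along X (along Y f) q = along X (\<lambda>x. \<Sum>c\<in>Basis. (Y x \<bullet> c) *\<^sub>R ?D c x) q"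
    by (rule arg_cong)
  have "((\<lambda>x. \<Sum>c\<in>Basis. (Y x \<bullet> c) *\<^sub>R ?D c x) has_derivative
      (\<lambda>v. \<Sum>c\<in>Basis. (Y q \<bullet> c) *\<^sub>R frechet_derivative (?D c) (at q) v +
        (frechet_derivative Y (at q) v \<bullet> c) *\<^sub>R ?D c q)) (at q)"
    by (intro has_derivative_sum has_derivative_scaleR has_derivative_inner_left
        smooth_has_derivative D Y)
  from along_eqI[OF this, of X, folded *] have "along X (along Y f) q =
      (\<Sum>c\<in>Basis. (Y q \<bullet> c) *\<^sub>R frechet_derivative (?D c) (at q) (X q) +
        (frechet_derivative Y (at q) (X q) \<bullet> c) *\<^sub>R ?D c q)"
    .
  also have "\<dots> = (\<Sum>c\<in>Basis. (Y q \<bullet> c) *\<^sub>R frechet_derivative (?D c) (at q) (X q)) +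
      (\<Sum>c\<in>Basis. (along X Y q \<bullet> c) *\<^sub>R ?D c q)"
    by (simp add: sum.distrib along_def)
  also have "(\<Sum>c\<in>Basis. (along X Y q \<bullet> c) *\<^sub>R ?D c q) = frechet_derivative f (at q) (along X Y q)"
    by (rule frechet_derivative_basis[OF f, symmetric])
  also have "(\<Sum>c\<in>Basis. (Y q \<bullet> c) *\<^sub>R frechet_derivative (?D c) (at q) (X q)) =
     (\<Sum>c\<in>Basis. \<Sum>b\<in>Basis. ((X q \<bullet> b) * (Y q \<bullet> c)) *\<^sub>R frechet_derivative (?D c) (at q) b)"
    unfolding frechet_derivative_basis[OF D, where v = "X q"]
    by (simp add: scaleR_sum_right mult.commute)
  also have "\<dots> =
     (\<Sum>b\<in>Basis. \<Sum>c\<in>Basis. ((X q \<bullet> b) * (Y q \<bullet> c)) *\<^sub>R frechet_derivative (?D c) (at q) b)"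
    by (rule sum.swap)
  finally show ?thesis
    by (rule trans[OF _ add.commute])
qed

lemma along_lie_bracket:
  fixes f :: "'a::euclidean_space \<Rightarrow> 'b::real_inner"
  assumes X: "smooth X" and Y: "smooth Y" and f: "smooth f"
  shows "along (\<lambda>q. along X Y q - along Y X q) f q = along X (along Y f) q - along Y (along X f) q"
proof -
  have "frechet_derivative f (at q) (along X Y q - along Y X q) =
      frechet_derivative f (at q) (along X Y q) - frechet_derivative f (at q) (along Y X q)"
    using smooth_imp_linear_derivative[OF f] by (simp add: linear_diff)
  moreover have "(\<Sum>b\<in>Basis. \<Sum>c\<in>Basis. ((X q \<bullet> b) * (Y q \<bullet> c)) *\<^sub>R
       frechet_derivative (\<lambda>x. frechet_derivative f (at x) c) (at q) b) =
     (\<Sum>b\<in>Basis. \<Sum>c\<in>Basis. ((Y q \<bullet> b) * (X q \<bullet> c)) *\<^sub>R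
       frechet_derivative (\<lambda>x. frechet_derivative f (at x) c) (at q) b)"
    by (subst sum.swap, intro sum.cong refl arg_cong2[where f = scaleR]
        second_derivative_symmetric f mult.commute)
  ultimately show ?thesis
    unfolding along_along[OF X Y f] along_along[OF Y X f]
      along_def[of "\<lambda>q. along X Y q - along Y X q"] by simp
qed

lemma along_add_field:
  "smooth f \<Longrightarrow> along (\<lambda>q. X q + Y q) f q = along X f q + along Y f q"
  using smooth_imp_linear_derivative[of f q] by (simp add: along_def linear_add)

lemma along_diff_field:
  "smooth f \<Longrightarrow> along (\<lambda>q. X q - Y q) f q = along X f q - along Y f q"
  using smooth_imp_linear_derivative[of f q] by (simp add: along_def linear_diff)

lemma along_scaleR_field:
  "smooth f \<Longrightarrow> along (\<lambda>q. g q *\<^sub>R X q) f q = g q *\<^sub>R along X f q"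
  using smooth_imp_linear_derivative[of f q] by (simp add: along_def linear_cmul)

lemma along_commutator:
  fixes f :: "real^3 \<Rightarrow> 'b::real_inner"
  shows "smooth X \<Longrightarrow> smooth Y \<Longrightarrow> smooth f \<Longrightarrow>
    along (lie_bracket X Y) f q = along X (along Y f) q - along Y (along X f) q"
  by (simp add: lie_bracket_eq_along along_lie_bracket)

text \<open>Writing every outer bracket with derivatives along fields, and the derivative along a bracket as a
commutator, leaves second derivatives of the components that cancel in pairs.\<close>

lemma lie_bracket_jacobi:
  assumes "smooth X" "smooth Y" "smooth W"
  shows "lie_bracket (lie_bracket X Y) W q =
    lie_bracket X (lie_bracket Y W) q - lie_bracket Y (lie_bracket X W) q"
proof -
  have "lie_bracket (lie_bracket X Y) W q =
      along X (along Y W) q - along Y (along X W) q - (along W (along X Y) q - along W (along Y X) q)"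
    using assms by (simp add: lie_bracket_eq_along[of "lie_bracket X Y"] along_commutator)
      (simp add: lie_bracket_eq_along)
  moreover have "lie_bracket X (lie_bracket Y W) q =
      along X (along Y W) q - along X (along W Y) q - (along Y (along W X) q - along W (along Y X) q)"
    using assms by (simp add: lie_bracket_eq_along[of _ "lie_bracket Y W"] along_commutator)
      (simp add: lie_bracket_eq_along)
  moreover have "lie_bracket Y (lie_bracket X W) q =
      along Y (along X W) q - along Y (along W X) q - (along X (along W Y) q - along W (along X Y) q)"
    using assms by (simp add: lie_bracket_eq_along[of _ "lie_bracket X W"] along_commutator)
      (simp add: lie_bracket_eq_along)
  ultimately show ?thesis by simp
qed

lemma lie_bracket_nth:
  "smooth X \<Longrightarrow> smooth Y \<Longrightarrow>
    lie_bracket X Y q $ i = along X (\<lambda>q. Y q $ i) q - along Y (\<lambda>q. X q $ i) q"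
  by (simp add: lie_bracket_eq_along along_nth)

lemma lie_bracket_add_right:
  "smooth X \<Longrightarrow> smooth Y \<Longrightarrow> smooth W \<Longrightarrow>
    lie_bracket X (\<lambda>q. Y q + W q) q = lie_bracket X Y q + lie_bracket X W q"
  by (simp add: lie_bracket_eq_along along_add_field)

lemma lie_bracket_diff_right:
  "smooth X \<Longrightarrow> smooth Y \<Longrightarrow> smooth W \<Longrightarrow>
    lie_bracket X (\<lambda>q. Y q - W q) q = lie_bracket X Y q - lie_bracket X W q"
  by (simp add: lie_bracket_eq_along along_diff_field)

lemma lie_bracket_scaleR_right:
  "smooth X \<Longrightarrow> smooth Y \<Longrightarrow> smooth f \<Longrightarrow>
    lie_bracket X (\<lambda>q. f q *\<^sub>R Y q) q = along X f q *\<^sub>R Y q + f q *\<^sub>R lie_bracket X Y q"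
  by (simp add: lie_bracket_eq_along along_scaleR_field algebra_simps)

section \<open>The Heisenberg frame\<close>

abbreviation S where "S \<equiv> heis_f1"
abbreviation T where "T \<equiv> heis_f2"

lemma field_components [simp]:
  "S q $ 1 = 0" "S q $ 2 = 1" "S q $ 3 = q$1 / 2"
  "T q $ 1 = 1" "T q $ 2 = 0" "T q $ 3 = - q$2 / 2"
  "F1 q $ 1 = 0" "F1 q $ 2 = 0" "F1 q $ 3 = 1"
  by (simp_all add: heis_f1_def heis_f2_def F1_def)

lemma inner_3: "p \<bullet> v = p$1 * v$1 + p$2 * v$2 + p$3 * v$3" for p v :: "real^3"
  by (simp add: inner_vec_def sum_3)

lemma vec3_eq_iff: "v = w \<longleftrightarrow> v$1 = w$1 \<and> v$2 = w$2 \<and> v$3 = w$3" for v w :: "'a^3"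
  by (simp add: vec_eq_iff forall_3)

lemma smooth_frame [simp]: "smooth S" "smooth T" "smooth F1"
  by (rule smooth_vec3I; simp)+

text \<open>The structure equations of the Heisenberg algebra; \<^const>\<open>F1\<close> is the central field \<open>\<partial>\<^sub>z\<close>.\<close>

lemma lie_bracket_T_S: "lie_bracket T S = F1"
  by (simp add: fun_eq_iff vec3_eq_iff lie_bracket_nth)

lemma lie_bracket_Z: "lie_bracket F1 T = (\<lambda>q. 0)" "lie_bracket F1 S = (\<lambda>q. 0)"
  by (simp_all add: fun_eq_iff vec3_eq_iff lie_bracket_nth)

lemma along_Z:
  fixes f :: "real^3 \<Rightarrow> 'b::real_inner"
  shows "smooth f \<Longrightarrow> along F1 f q = along T (along S f) q - along S (along T f) q"
  using along_commutator[of T S f q] by (simp add: lie_bracket_T_S)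

lemma along_Z_commute:
  fixes f :: "real^3 \<Rightarrow> 'b::real_inner"
  assumes "smooth f"
  shows "along F1 (along T f) q = along T (along F1 f) q"
    "along F1 (along S f) q = along S (along F1 f) q"
  using along_commutator[of F1 T f q] along_commutator[of F1 S f q] assms smooth_imp_linear_derivative[of f q]
  by (simp_all add: lie_bracket_Z along_def[of "\<lambda>q. 0"] linear_0)

text \<open>The frame is bracket generating: \<open>\<partial>\<^sub>z f = T (S f) - S (T f)\<close> vanishes as well, so all directional
derivatives do.\<close>

lemma constant_if_horizontally_constant:
  fixes f :: "real^3 \<Rightarrow> 'b::real_inner"
  assumes f: "smooth f" and "\<And>q. along T f q = 0" "\<And>q. along S f q = 0"
  shows "f q = f 0"
proof -
  have TS: "along T f = (\<lambda>q. 0)" "along S f = (\<lambda>q. 0)" using assms by auto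
  have Z: "along F1 f q = 0" for q by (simp add: along_Z[OF f] TS)
  have "frechet_derivative f (at q) v = 0" for q v
  proof -
    have v: "v = v$1 *\<^sub>R T q + v$2 *\<^sub>R S q + (v$3 + q$2 / 2 * v$1 - q$1 / 2 * v$2) *\<^sub>R F1 q"
      by (simp add: vec3_eq_iff)
    have "frechet_derivative f (at q) v = v$1 *\<^sub>R along T f q + v$2 *\<^sub>R along S f q +
        (v$3 + q$2 / 2 * v$1 - q$1 / 2 * v$2) *\<^sub>R along F1 f q"
      using smooth_imp_linear_derivative[OF f, of q] unfolding along_def
      by (subst v) (simp only: linear_add linear_cmul)
    then show ?thesis by (simp add: TS Z)
  qed
  then have "(f has_derivative (\<lambda>v. 0)) (at q)" for q
    using smooth_has_derivative[OF f, of q] by (metis ext)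
  then show ?thesis
    by (intro has_derivative_zero_unique[of UNIV]) auto
qed

section \<open>Conformal fields as similarities of the frame\<close>

text \<open>The Poisson bracket is a derivation in its second argument.\<close>

lemma poisson_half_sum_squares:
  assumes "G1 differentiable (at l)" "G2 differentiable (at l)"
  shows "poisson F (\<lambda>l. ((G1 l)\<^sup>2 + (G2 l)\<^sup>2) / 2) l =
    G1 l * poisson F G1 l + G2 l * poisson F G2 l"
proof -
  have "((\<lambda>l. ((G1 l)\<^sup>2 + (G2 l)\<^sup>2) / 2) has_derivative
      (\<lambda>v. G1 l * frechet_derivative G1 (at l) v + G2 l * frechet_derivative G2 (at l) v)) (at l)"
    using assms unfolding frechet_derivative_works
    by (auto intro!: derivative_eq_intros simp: fun_eq_iff)
  then have "frechet_derivative (\<lambda>l. ((G1 l)\<^sup>2 + (G2 l)\<^sup>2) / 2) (at l) =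
      (\<lambda>v. G1 l * frechet_derivative G1 (at l) v + G2 l * frechet_derivative G2 (at l) v)"
    by (rule frechet_derivative_at[symmetric])
  then show ?thesis
    by (simp add: poisson_def sum_3 algebra_simps)
qed

lemma lift_differentiable:
  assumes "smooth Y"
  shows "lift Y differentiable (at l)"
proof -
  have Y: "(Y has_derivative frechet_derivative Y (at (fst l))) (at (fst l))"
    using smooth_has_derivative[OF assms] .
  have "((\<lambda>l. Y (fst l)) has_derivative (\<lambda>v. frechet_derivative Y (at (fst l)) (fst v))) (at l)"
    by (rule has_derivative_compose[where f = fst and f' = fst, OF _ Y])
      (simp add: bounded_linear_imp_has_derivative bounded_linear_fst)
  then have "((\<lambda>l. snd l \<bullet> Y (fst l)) has_derivative
      (\<lambda>v. snd l \<bullet> frechet_derivative Y (at (fst l)) (fst v) + snd v \<bullet> Y (fst l))) (at l)"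
    by (intro has_derivative_inner) (auto intro: derivative_eq_intros)
  then show ?thesis
    by (auto simp: lift_def case_prod_unfold intro: differentiableI)
qed

lemma poisson_hamiltonian:
  assumes "smooth X"
  shows "poisson (lift X) heis_hamiltonian (q, p) =
    (p \<bullet> T q) * (p \<bullet> lie_bracket X T q) + (p \<bullet> S q) * (p \<bullet> lie_bracket X S q)"
proof -
  have h: "heis_hamiltonian = (\<lambda>l. ((lift S l)\<^sup>2 + (lift T l)\<^sup>2) / 2)"
    by (simp add: fun_eq_iff heis_hamiltonian_def)
  have "poisson (lift X) heis_hamiltonian (q, p) =
      lift S (q, p) * poisson (lift X) (lift S) (q, p) +
      lift T (q, p) * poisson (lift X) (lift T) (q, p)"
    unfolding h by (intro poisson_half_sum_squares lift_differentiable smooth_frame)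
  then show ?thesis
    using assms by (simp add: poisson_lift_lift smooth_differentiable) (simp add: lift_def)
qed

text \<open>Both sides are quadratic forms in the covector \<open>p\<close>, so it suffices to compare coefficients in the
coframe dual to \<open>T, S, \<partial>\<^sub>z\<close>. It consists of \<open>dx\<close>, \<open>dy\<close> and the contact form
\<open>y/2 dx - x/2 dy + dz\<close>, the vector \<open>?t\<close> of the proof: the coefficients of \<open>dx\<^sup>2\<close>, \<open>dy\<^sup>2\<close> and \<open>dx dy\<close> give
the horizontal parts of \<open>A\<close> and \<open>B\<close>, the mixed ones with \<open>?t\<close> exclude a vertical part.\<close>

lemma conformal_covector_condition:
  fixes A B :: "real^3"
  assumes "\<And>p. (p \<bullet> T q) * (p \<bullet> A) + (p \<bullet> S q) * (p \<bullet> B) = e * ((p \<bullet> T q)\<^sup>2 + (p \<bullet> S q)\<^sup>2)"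
  shows "A = e *\<^sub>R T q - B$1 *\<^sub>R S q" and "B = B$1 *\<^sub>R T q + e *\<^sub>R S q"
proof -
  let ?t = "vector [q$2 / 2, - q$1 / 2, 1] :: real^3"
  have 1: "A$1 = e"
    using assms[of "axis 1 1"] by (simp add: inner_axis')
  have 2: "B$2 = e"
    using assms[of "axis 2 1"] by (simp add: inner_axis')
  have 3: "A$2 + B$1 = 0"
    using assms[of "axis 1 1 + axis 2 1"] 1 2 by (simp add: inner_axis' inner_add_left)
  have 4: "?t \<bullet> A = 0"
    using assms[of "axis 1 1 + ?t"] 1 by (simp add: inner_axis' inner_add_left) (simp add: inner_3)
  have 5: "?t \<bullet> B = 0"
    using assms[of "axis 2 1 + ?t"] 2 by (simp add: inner_axis' inner_add_left) (simp add: inner_3)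
  from 3 have 6: "A$2 = - B$1" by simp
  show "A = e *\<^sub>R T q - B$1 *\<^sub>R S q" "B = B$1 *\<^sub>R T q + e *\<^sub>R S q"
    using 4 5 by (simp_all add: vec3_eq_iff 1 2 6 inner_3 algebra_simps)
qed

text \<open>Bracketing with \<open>X\<close> must scale the frame by \<open>\<eta>\<close>, up to an infinitesimal rotation \<open>\<mu>\<close> that the
sum of squares does not see.\<close>

lemma conformal_factor_iff_lie_bracket:
  assumes X: "smooth X"
  shows "conformal_factor X \<eta> \<longleftrightarrow> smooth \<eta> \<and> (\<exists>\<mu>. smooth \<mu> \<and>
    lie_bracket X T = (\<lambda>q. \<eta> q *\<^sub>R T q - \<mu> q *\<^sub>R S q) \<and>
    lie_bracket X S = (\<lambda>q. \<mu> q *\<^sub>R T q + \<eta> q *\<^sub>R S q))"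
proof -
  have *: "conformal_factor X \<eta> \<longleftrightarrow> smooth \<eta> \<and>
    (\<forall>q p. (p \<bullet> T q) * (p \<bullet> lie_bracket X T q) + (p \<bullet> S q) * (p \<bullet> lie_bracket X S q) =
      \<eta> q * ((p \<bullet> T q)\<^sup>2 + (p \<bullet> S q)\<^sup>2))"
    unfolding conformal_factor_def split_paired_All poisson_hamiltonian[OF X]
    by (simp add: pullback_def heis_hamiltonian_def lift_def add.commute)
  show ?thesis
  proof (intro iffI conjI)
    assume "conformal_factor X \<eta>"
    then have c: "lie_bracket X T q = \<eta> q *\<^sub>R T q - lie_bracket X S q $ 1 *\<^sub>R S q"
      "lie_bracket X S q = lie_bracket X S q $ 1 *\<^sub>R T q + \<eta> q *\<^sub>R S q" for q
      unfolding * by (intro conformal_covector_condition; blast)+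
    show "smooth \<eta>" using \<open>conformal_factor X \<eta>\<close> by (simp add: conformal_factor_def)
    show "\<exists>\<mu>. smooth \<mu> \<and> lie_bracket X T = (\<lambda>q. \<eta> q *\<^sub>R T q - \<mu> q *\<^sub>R S q) \<and>
      lie_bracket X S = (\<lambda>q. \<mu> q *\<^sub>R T q + \<eta> q *\<^sub>R S q)"
      using X c by (intro exI[of _ "\<lambda>q. lie_bracket X S q $ 1"]) auto
  next
    assume "smooth \<eta> \<and> (\<exists>\<mu>. smooth \<mu> \<and> lie_bracket X T = (\<lambda>q. \<eta> q *\<^sub>R T q - \<mu> q *\<^sub>R S q) \<and>
      lie_bracket X S = (\<lambda>q. \<mu> q *\<^sub>R T q + \<eta> q *\<^sub>R S q))"
    then obtain \<mu> where "smooth \<eta>" and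
      m: "lie_bracket X T = (\<lambda>q. \<eta> q *\<^sub>R T q - \<mu> q *\<^sub>R S q)"
      "lie_bracket X S = (\<lambda>q. \<mu> q *\<^sub>R T q + \<eta> q *\<^sub>R S q)" by blast
    then show "conformal_factor X \<eta>"
      unfolding * m by (simp add: power2_eq_square algebra_simps)
  qed
qed

text \<open>By the Jacobi identity, bracketing the frame with \<open>[X, Y]\<close> is the commutator of bracketing with \<open>X\<close>
and with \<open>Y\<close>. The products of \<open>\<eta>, \<mu>\<close> with \<open>\<theta>, \<nu>\<close> cancel, because dilations and rotations of the
plane commute, and only derivatives of these functions remain.\<close>

lemma conformal_factor_lie_bracket:
  assumes X: "smooth X" and Y: "smooth Y"
    and "conformal_factor X \<eta>" and "conformal_factor Y \<theta>"
  shows "conformal_factor (lie_bracket X Y) (\<lambda>q. along X \<theta> q - along Y \<eta> q)"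
proof -
  obtain \<mu> where \<eta>: "smooth \<eta>" "smooth \<mu>"
    "lie_bracket X T = (\<lambda>q. \<eta> q *\<^sub>R T q - \<mu> q *\<^sub>R S q)"
    "lie_bracket X S = (\<lambda>q. \<mu> q *\<^sub>R T q + \<eta> q *\<^sub>R S q)"
    using assms(3) conformal_factor_iff_lie_bracket[OF X] by blast
  obtain \<nu> where \<theta>: "smooth \<theta>" "smooth \<nu>"
    "lie_bracket Y T = (\<lambda>q. \<theta> q *\<^sub>R T q - \<nu> q *\<^sub>R S q)"
    "lie_bracket Y S = (\<lambda>q. \<nu> q *\<^sub>R T q + \<theta> q *\<^sub>R S q)"
    using assms(4) conformal_factor_iff_lie_bracket[OF Y] by blast
  show ?thesis
    unfolding conformal_factor_iff_lie_bracket[OF smooth_lie_bracket[OF X Y]]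
  proof (intro conjI exI[of _ "\<lambda>q. along X \<nu> q - along Y \<mu> q"])
    show "smooth (\<lambda>q. along X \<theta> q - along Y \<eta> q)" "smooth (\<lambda>q. along X \<nu> q - along Y \<mu> q)"
      using X Y \<eta> \<theta> by simp_all
    show "lie_bracket (lie_bracket X Y) T = (\<lambda>q. (along X \<theta> q - along Y \<eta> q) *\<^sub>R T q -
        (along X \<nu> q - along Y \<mu> q) *\<^sub>R S q)"
      using X Y \<eta>(1,2) \<theta>(1,2)
      by (simp add: fun_eq_iff lie_bracket_jacobi \<eta>(3,4) \<theta>(3,4) lie_bracket_diff_right
          lie_bracket_scaleR_right) (simp add: algebra_simps)
    show "lie_bracket (lie_bracket X Y) S = (\<lambda>q. (along X \<nu> q - along Y \<mu> q) *\<^sub>R T q +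
        (along X \<theta> q - along Y \<eta> q) *\<^sub>R S q)"
      using X Y \<eta>(1,2) \<theta>(1,2)
      by (simp add: fun_eq_iff lie_bracket_jacobi \<eta>(3,4) \<theta>(3,4) lie_bracket_add_right
          lie_bracket_scaleR_right) (simp add: algebra_simps)
  qed
qed

section \<open>The contact Hamiltonian and prolongation\<close>

text \<open>The contraction with the contact form \<open>dz + y/2 dx - x/2 dy\<close>, which annihilates the frame.\<close>

definition contact :: "field3 \<Rightarrow> real^3 \<Rightarrow> real" where
  "contact X q = X q $ 3 + q$2 / 2 * X q $ 1 - q$1 / 2 * X q $ 2"

lemma smooth_contact [simp]: "smooth X \<Longrightarrow> smooth (contact X)"
  unfolding contact_def[abs_def] by simp

text \<open>The linear algebra at one point behind the next lemma: \<open>ta\<close>, \<open>sa\<close>, \<open>tb\<close>, \<open>sb\<close>, \<open>t3\<close>, \<open>s3\<close> stand for the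
derivatives of the three components along \<open>T\<close> and \<open>S\<close>. The first system is the similarity condition
read off by components, the second one has the third component replaced by the contact
Hamiltonian, whose equations no longer involve \<open>\<eta>\<close> and \<open>\<mu>\<close>.\<close>

lemma conformal_system_iff:
  fixes ta tb t3 sa sb s3 a b e m x y :: real
  shows "- ta = e \<and> tb = m \<and> - sa = m \<and> - sb = e \<and>
      - b / 2 - t3 = - y / 2 * e - x / 2 * m \<and> a / 2 - s3 = - y / 2 * m + x / 2 * e \<longleftrightarrow>
    m = tb \<and> ta = - e \<and> sb = - e \<and> sa = - tb \<and>
      t3 + y / 2 * ta - x / 2 * tb - b / 2 = - b \<and> s3 + y / 2 * sa - x / 2 * sb + a / 2 = a"
proof -
  have "- ta = e \<longleftrightarrow> ta = - e" "tb = m \<longleftrightarrow> m = tb"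
    "- sa = m \<longleftrightarrow> sa = - m" "- sb = e \<longleftrightarrow> sb = - e" by auto
  then show ?thesis by (auto simp: algebra_simps)
qed

lemma conformal_factor_iff_contact:
  assumes X: "smooth X"
  shows "conformal_factor X \<eta> \<longleftrightarrow> smooth \<eta> \<and> (\<forall>q.
    along T (\<lambda>q. X q $ 1) q = - \<eta> q \<and> along S (\<lambda>q. X q $ 2) q = - \<eta> q \<and>
    along S (\<lambda>q. X q $ 1) q = - along T (\<lambda>q. X q $ 2) q \<and>
    along T (contact X) q = - X q $ 2 \<and> along S (contact X) q = X q $ 1)"
proof -
  have c: "along T (contact X) q = along T (\<lambda>q. X q $ 3) q + q$2 / 2 * along T (\<lambda>q. X q $ 1) q -
      q$1 / 2 * along T (\<lambda>q. X q $ 2) q - X q $ 2 / 2"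
    "along S (contact X) q = along S (\<lambda>q. X q $ 3) q + q$2 / 2 * along S (\<lambda>q. X q $ 1) q -
      q$1 / 2 * along S (\<lambda>q. X q $ 2) q + X q $ 1 / 2" for q
    using X unfolding contact_def[abs_def] by (simp_all add: field_simps)
  have "(lie_bracket X T q = \<eta> q *\<^sub>R T q - \<mu> q *\<^sub>R S q \<and>
      lie_bracket X S q = \<mu> q *\<^sub>R T q + \<eta> q *\<^sub>R S q) \<longleftrightarrow>
    (\<mu> q = along T (\<lambda>q. X q $ 2) q \<and>
    along T (\<lambda>q. X q $ 1) q = - \<eta> q \<and> along S (\<lambda>q. X q $ 2) q = - \<eta> q \<and>
    along S (\<lambda>q. X q $ 1) q = - along T (\<lambda>q. X q $ 2) q \<and>
    along T (contact X) q = - X q $ 2 \<and> along S (contact X) q = X q $ 1)" for q \<mu>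
  proof -
    let ?L = "lie_bracket X T q = \<eta> q *\<^sub>R T q - \<mu> q *\<^sub>R S q \<and>
      lie_bracket X S q = \<mu> q *\<^sub>R T q + \<eta> q *\<^sub>R S q"
    have L: "?L \<longleftrightarrow>
      - along T (\<lambda>q. X q $ 1) q = \<eta> q \<and> along T (\<lambda>q. X q $ 2) q = \<mu> q \<and>
      - along S (\<lambda>q. X q $ 1) q = \<mu> q \<and> - along S (\<lambda>q. X q $ 2) q = \<eta> q \<and>
      - X q $ 2 / 2 - along T (\<lambda>q. X q $ 3) q = - q$2 / 2 * \<eta> q - q$1 / 2 * \<mu> q \<and>
      X q $ 1 / 2 - along S (\<lambda>q. X q $ 3) q = - q$2 / 2 * \<mu> q + q$1 / 2 * \<eta> q"
      using X by (auto simp: vec3_eq_iff lie_bracket_nth mult.commute)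
    show ?thesis unfolding L c by (rule conformal_system_iff)
  qed
  note pointwise = this
  have "smooth (along T (\<lambda>q. X q $ 2))" using X by simp
  then show ?thesis
    unfolding conformal_factor_iff_lie_bracket[OF X] fun_eq_iff
    by (simp only: all_conj_distrib[symmetric] pointwise) auto
qed

text \<open>Since \<open>\<partial>\<^sub>z\<close> is the commutator of \<open>T\<close> and \<open>S\<close> and commutes with them, each derivative along \<open>\<partial>\<^sub>z\<close> can
be computed in two or three ways. Comparing them expresses every second horizontal derivative of \<open>\<eta>\<close> by
\<open>\<partial>\<^sub>z \<eta>\<close> and the derivatives of \<open>\<mu> = T b\<close> by those of \<open>\<eta>\<close>.\<close>

lemma conformal_prolongation:
  fixes a b c \<eta> :: "real^3 \<Rightarrow> real"
  assumes smooth: "smooth a" "smooth b" "smooth c" "smooth \<eta>"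
    and Ta: "along T a = (\<lambda>q. - \<eta> q)" and Sb: "along S b = (\<lambda>q. - \<eta> q)"
    and Sa: "along S a = (\<lambda>q. - along T b q)"
    and Tc: "along T c = (\<lambda>q. - b q)" and Sc: "along S c = a"
  shows "along T (along T b) = (\<lambda>q. 3 * along S \<eta> q)"
    and "along S (along T b) = (\<lambda>q. - 3 * along T \<eta> q)"
    and "along T (along T \<eta>) = (\<lambda>q. 0)" and "along S (along S \<eta>) = (\<lambda>q. 0)"
    and "along T (along S \<eta>) = (\<lambda>q. along F1 \<eta> q / 2)"
    and "along S (along T \<eta>) = (\<lambda>q. - along F1 \<eta> q / 2)"
    and "along T (along F1 \<eta>) = (\<lambda>q. 0)" and "along S (along F1 \<eta>) = (\<lambda>q. 0)"
proof -
  have Zc: "along F1 c = (\<lambda>q. - 2 * \<eta> q)"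
    using smooth by (simp add: fun_eq_iff along_Z Sc Tc Ta Sb)
  have Za: "along F1 a = (\<lambda>q. - 2 * along S \<eta> q)"
    using along_Z_commute(2)[OF smooth(3)] smooth by (simp add: fun_eq_iff Sc Zc)
  have Zb: "along F1 b = (\<lambda>q. 2 * along T \<eta> q)"
    using along_Z_commute(1)[OF smooth(3)] smooth by (simp add: fun_eq_iff Tc Zc)
  show T\<mu>: "along T (along T b) = (\<lambda>q. 3 * along S \<eta> q)"
    using along_Z[OF smooth(1)] smooth by (simp add: fun_eq_iff Za Sa Ta)
  show S\<mu>: "along S (along T b) = (\<lambda>q. - 3 * along T \<eta> q)"
    using along_Z[OF smooth(2)] smooth by (simp add: fun_eq_iff Zb Sb)
  \<comment> \<open>Three expressions for \<open>\<partial>\<^sub>z \<mu>\<close> force it to vanish: \<open>2 T T \<eta> = 2 S S \<eta> = - 3 T T \<eta> - 3 S S \<eta>\<close>.\<close>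
  have Z\<mu>_T: "along F1 (along T b) q = 2 * along T (along T \<eta>) q" for q
    using along_Z_commute(1)[OF smooth(2)] smooth by (simp add: Zb)
  have Z\<mu>_S: "along F1 (along T b) q = 2 * along S (along S \<eta>) q" for q
    using along_Z_commute(2)[OF smooth(1)] smooth by (simp add: Za Sa)
  have Z\<mu>: "along F1 (along T b) q = - 3 * along T (along T \<eta>) q - 3 * along S (along S \<eta>) q" for q
    using along_Z[of "along T b" q] smooth by (simp add: T\<mu> S\<mu>)
  show TT: "along T (along T \<eta>) = (\<lambda>q. 0)" and SS: "along S (along S \<eta>) = (\<lambda>q. 0)"
  proof -
    have "along T (along T \<eta>) q = 0 \<and> along S (along S \<eta>) q = 0" for q
      using Z\<mu>[of q] Z\<mu>_T[of q] Z\<mu>_S[of q] by linarith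
    then show "along T (along T \<eta>) = (\<lambda>q. 0)" "along S (along S \<eta>) = (\<lambda>q. 0)"
      by (simp_all add: fun_eq_iff)
  qed
  have TS: "along T (along S \<eta>) q = along F1 \<eta> q / 2" for q
    using along_Z_commute(1)[OF smooth(1), of q] smooth by (simp add: Za Ta)
  then show TS': "along T (along S \<eta>) = (\<lambda>q. along F1 \<eta> q / 2)" by auto
  have "along S (along T \<eta>) q = - along F1 \<eta> q / 2" for q
    using along_Z[OF smooth(4), of q] TS[of q] by linarith
  then show ST: "along S (along T \<eta>) = (\<lambda>q. - along F1 \<eta> q / 2)" by auto
  \<comment> \<open>Here \<open>\<partial>\<^sub>z (T \<eta>) = T (S (T \<eta>)) = - T (\<partial>\<^sub>z \<eta>) / 2\<close>, although \<open>\<partial>\<^sub>z\<close> and \<open>T\<close> commute; likewise for \<open>S\<close>.\<close>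
  have "along T (along F1 \<eta>) q = 0" for q
    using along_Z[of "along T \<eta>" q] along_Z_commute(1)[OF smooth(4), of q] smooth
    by (simp add: ST TT)
  then show "along T (along F1 \<eta>) = (\<lambda>q. 0)" by auto
  have "along S (along F1 \<eta>) q = 0" for q
    using along_Z[of "along S \<eta>" q] along_Z_commute(2)[OF smooth(4), of q] smooth
    by (simp add: TS' SS)
  then show "along S (along F1 \<eta>) = (\<lambda>q. 0)" by auto
qed

lemma zero_if_horizontally_constant:
  fixes f :: "real^3 \<Rightarrow> real"
  assumes "smooth f" "along T f = (\<lambda>q. 0)" "along S f = (\<lambda>q. 0)" "f 0 = 0"
  shows "f = (\<lambda>q. 0)"
  using constant_if_horizontally_constant[OF assms(1)] assms by (simp add: fun_eq_iff)

text \<open>The unknowns of the prolonged system vanish one after the other, from the highest derivative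
down: as soon as the preceding ones are zero, the next is horizontally constant and its value at the
origin is zero.\<close>

lemma conformal_field_determined_by_jet:
  assumes X: "smooth X" and c: "conformal_factor X \<eta>"
    and zero: "X 0 = 0" "along T (\<lambda>q. X q $ 2) 0 = 0" "\<eta> 0 = 0"
      "along T \<eta> 0 = 0" "along S \<eta> 0 = 0" "along F1 \<eta> 0 = 0"
  shows "X = (\<lambda>q. 0)"
proof -
  let ?a = "\<lambda>q. X q $ 1" and ?b = "\<lambda>q. X q $ 2"
  have \<eta>: "smooth \<eta>" and eqs: "along T ?a = (\<lambda>q. - \<eta> q)" "along S ?b = (\<lambda>q. - \<eta> q)"
    "along S ?a = (\<lambda>q. - along T ?b q)" "along T (contact X) = (\<lambda>q. - ?b q)"
    "along S (contact X) = ?a"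
    using c unfolding conformal_factor_iff_contact[OF X] by (simp_all add: fun_eq_iff)
  have smooth: "smooth ?a" "smooth ?b" "smooth (contact X)" using X by simp_all
  note pro = conformal_prolongation[OF smooth \<eta> eqs]
  have Z\<eta>: "along F1 \<eta> = (\<lambda>q. 0)"
    by (rule zero_if_horizontally_constant) (use zero \<eta> pro in \<open>simp_all\<close>)
  have T\<eta>: "along T \<eta> = (\<lambda>q. 0)"
    by (rule zero_if_horizontally_constant) (use zero \<eta> pro Z\<eta> in \<open>simp_all\<close>)
  have S\<eta>: "along S \<eta> = (\<lambda>q. 0)"
    by (rule zero_if_horizontally_constant) (use zero \<eta> pro Z\<eta> in \<open>simp_all\<close>)
  have \<eta>0: "\<eta> = (\<lambda>q. 0)"
    by (rule zero_if_horizontally_constant) (use zero \<eta> T\<eta> S\<eta> in \<open>simp_all\<close>)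
  have \<mu>0: "along T ?b = (\<lambda>q. 0)"
    by (rule zero_if_horizontally_constant) (use zero X pro T\<eta> S\<eta> in \<open>simp_all\<close>)
  have b0: "?b = (\<lambda>q. 0)"
    by (rule zero_if_horizontally_constant) (use zero smooth eqs \<eta>0 \<mu>0 in \<open>simp_all\<close>)
  have a0: "?a = (\<lambda>q. 0)"
    by (rule zero_if_horizontally_constant) (use zero smooth eqs \<eta>0 \<mu>0 in \<open>simp_all\<close>)
  have ab: "X q $ 1 = 0" "X q $ 2 = 0" for q
    using a0 b0 by (simp_all add: fun_eq_iff)
  have "contact X = (\<lambda>q. 0)"
    by (rule zero_if_horizontally_constant)
      (use X zero in \<open>simp_all add: eqs(4,5) ab contact_def\<close>)
  then have "contact X q = 0" for q by simp
  with ab show ?thesis by (simp add: fun_eq_iff vec3_eq_iff contact_def)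
qed

lemma conformal_factor_unique:
  assumes "smooth X" "conformal_factor X \<eta>" "conformal_factor X \<theta>"
  shows "\<eta> = \<theta>"
  using assms(2,3) unfolding conformal_factor_iff_contact[OF assms(1)]
  by (auto simp: fun_eq_iff)

lemma conformal_factor_iff_eq:
  "smooth X \<Longrightarrow> conformal_factor X \<theta> \<Longrightarrow> conformal_factor X \<eta> \<longleftrightarrow> \<eta> = \<theta>"
  using conformal_factor_unique by blast

section \<open>The eight generators\<close>

lemma contact_add: "contact (\<lambda>q. X q + Y q) = (\<lambda>q. contact X q + contact Y q)"
  by (simp add: contact_def fun_eq_iff algebra_simps)

lemma contact_scaleR: "contact (\<lambda>q. r *\<^sub>R X q) = (\<lambda>q. r * contact X q)"
  by (simp add: contact_def fun_eq_iff algebra_simps)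

lemma conformal_factor_add:
  "smooth X \<Longrightarrow> smooth Y \<Longrightarrow> conformal_factor X \<eta> \<Longrightarrow> conformal_factor Y \<theta> \<Longrightarrow>
    conformal_factor (\<lambda>q. X q + Y q) (\<lambda>q. \<eta> q + \<theta> q)"
  by (simp add: conformal_factor_iff_contact contact_add)

lemma conformal_factor_scaleR:
  "smooth X \<Longrightarrow> conformal_factor X \<eta> \<Longrightarrow> conformal_factor (\<lambda>q. r *\<^sub>R X q) (\<lambda>q. r * \<eta> q)"
  by (simp add: conformal_factor_iff_contact contact_scaleR)

lemma generator_components [simp]:
  "F2 q $ 1 = 1" "F2 q $ 2 = 0" "F2 q $ 3 = q$2 / 2"
  "F3 q $ 1 = 0" "F3 q $ 2 = 1" "F3 q $ 3 = - q$1 / 2"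
  "F4 q $ 1 = - q$2" "F4 q $ 2 = q$1" "F4 q $ 3 = 0"
  "F5 q $ 1 = - q$1" "F5 q $ 2 = - q$2" "F5 q $ 3 = - 2 * q$3"
  "F6 q $ 1 = (3 * (q$2)^2 - (q$1)^2) / 2" "F6 q $ 2 = 2 * (q$3 - q$1 * q$2)"
  "F6 q $ 3 = - q$1 * q$3 - (q$1)^2 * q$2 / 4 - (q$2)^3 / 4"
  "F7 q $ 1 = - 2 * (q$3 + q$1 * q$2)" "F7 q $ 2 = (3 * (q$1)^2 - (q$2)^2) / 2"
  "F7 q $ 3 = - q$2 * q$3 + (q$1)^3 / 4 + q$1 * (q$2)^2 / 4"
  "F8 q $ 1 = - q$1 * q$3 - (q$1)^2 * q$2 / 4 - (q$2)^3 / 4"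
  "F8 q $ 2 = - q$2 * q$3 + q$1 * (q$2)^2 / 4 + (q$1)^3 / 4"
  "F8 q $ 3 = - ((q$3)^2) + ((q$1)^2 + (q$2)^2)^2 / 16"
  by (simp_all add: F2_def F3_def F4_def F5_def F6_def F7_def F8_def Let_def)

lemma smooth_generators [simp]:
  "smooth F2" "smooth F3" "smooth F4" "smooth F5" "smooth F6" "smooth F7" "smooth F8"
  by (rule smooth_vec3I; simp)+

lemma contact_generators:
  "contact F1 = (\<lambda>q. 1)" "contact F2 = (\<lambda>q. q$2)" "contact F3 = (\<lambda>q. - q$1)"
  "contact F4 = (\<lambda>q. - ((q$1)^2 + (q$2)^2) / 2)" "contact F5 = (\<lambda>q. - 2 * q$3)"
  "contact F6 = (\<lambda>q. q$2 * ((q$1)^2 + (q$2)^2) / 2 - 2 * q$1 * q$3)"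
  "contact F7 = (\<lambda>q. - q$1 * ((q$1)^2 + (q$2)^2) / 2 - 2 * q$2 * q$3)"
  "contact F8 = (\<lambda>q. - ((q$3)^2) - ((q$1)^2 + (q$2)^2)^2 / 16)"
  by (simp_all add: contact_def fun_eq_iff field_simps power2_eq_square power3_eq_cube)

lemma conformal_factor_generators:
  "conformal_factor F1 (\<lambda>q. 0)" "conformal_factor F2 (\<lambda>q. 0)" "conformal_factor F3 (\<lambda>q. 0)"
  "conformal_factor F4 (\<lambda>q. 0)" "conformal_factor F5 (\<lambda>q. 1)" "conformal_factor F6 (\<lambda>q. q$1)"
  "conformal_factor F7 (\<lambda>q. q$2)" "conformal_factor F8 (\<lambda>q. q$3)"
  by (simp_all add: conformal_factor_iff_contact contact_generators)
    (simp_all add: field_simps power2_eq_square power3_eq_cube)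

text \<open>Coefficients are indexed by numbers from 0, so \<open>r i\<close> belongs to the field with number \<open>i + 1\<close>. The
pointwise form suits the computation of derivatives.\<close>

definition generator_combination :: "(nat \<Rightarrow> real) \<Rightarrow> field3" where
  "generator_combination r = (\<lambda>q. r 0 *\<^sub>R F1 q + r 1 *\<^sub>R F2 q + r 2 *\<^sub>R F3 q + r 3 *\<^sub>R F4 q +
     r 4 *\<^sub>R F5 q + r 5 *\<^sub>R F6 q + r 6 *\<^sub>R F7 q + r 7 *\<^sub>R F8 q)"

lemma smooth_generator_combination [simp]: "smooth (generator_combination r)"
  by (simp add: generator_combination_def)

lemma generator_combination_eq_sum:
  "generator_combination r = (\<Sum>i<8. r i *\<^sub>R [F1, F2, F3, F4, F5, F6, F7, F8] ! i)"
  by (simp add: generator_combination_def fun_eq_iff scaleR_fun_def numeral_eq_Suc)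

lemma conformal_factor_generator_combination:
  "conformal_factor (generator_combination r) (\<lambda>q. r 4 + r 5 * q$1 + r 6 * q$2 + r 7 * q$3)"
proof -
  have "conformal_factor (generator_combination r) (\<lambda>q. r 0 * 0 + r 1 * 0 + r 2 * 0 + r 3 * 0 +
     r 4 * 1 + r 5 * q$1 + r 6 * q$2 + r 7 * q$3)"
    unfolding generator_combination_def
    by (intro conformal_factor_add conformal_factor_scaleR conformal_factor_generators) simp_all
  then show ?thesis by simp
qed

lemma conformal_factor_zero: "conformal_factor (\<lambda>q. 0) (\<lambda>q. 0)"
  using conformal_factor_scaleR[OF smooth_frame(3) conformal_factor_generators(1), of 0] by simp

text \<open>The zero field has conformal factor zero only, which kills the coefficients of the fields with a
nonzero factor. At the origin only the first three fields are nonzero, and the rotation is left,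
which shows at \<open>(1, 0, 0)\<close>.\<close>

lemma generator_combination_eq_zeroD:
  assumes "generator_combination r = 0" and "i < 8"
  shows "r i = 0"
proof -
  have z: "generator_combination r = (\<lambda>q. 0)" using assms by (simp add: zero_fun_def)
  have "(\<lambda>q. r 4 + r 5 * q$1 + r 6 * q$2 + r 7 * q$3) = (\<lambda>q::real^3. 0)"
    by (rule conformal_factor_unique[of "generator_combination r"])
      (use conformal_factor_generator_combination[of r] conformal_factor_zero z in simp_all)
  then have \<eta>: "r 4 + r 5 * q$1 + r 6 * q$2 + r 7 * q$3 = 0" for q :: "real^3"
    by meson
  have r47: "r 4 = 0" "r 5 = 0" "r 6 = 0" "r 7 = 0"
    using \<eta>[of 0] \<eta>[of "axis 1 1"] \<eta>[of "axis 2 1"] \<eta>[of "axis 3 1"] by (simp_all add: axis_def)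
  have comp: "generator_combination r q $ j = 0" for q j using z by simp
  have r02: "r 0 = 0" "r 1 = 0" "r 2 = 0"
    using comp[of 0 3] comp[of 0 1] comp[of 0 2] by (simp_all add: generator_combination_def r47)
  have "r 3 = 0"
    using comp[of "axis 1 1" 2] by (simp add: generator_combination_def r47 r02)
  then show ?thesis
    using r02 r47 \<open>i < 8\<close> by (auto simp: numeral_eq_Suc less_Suc_eq)
qed

text \<open>At the origin the jet of the combination with coefficients \<open>r\<close> consists of the numbers \<open>r\<close>, in
the order used below. So these coefficients are read off from the jet of \<open>X\<close>, and the difference
has vanishing jet.\<close>

lemma conformal_field_is_combination:
  assumes X: "smooth X" and c: "conformal_factor X \<eta>"
  shows "\<exists>r. X = generator_combination r"
proof -
  define r where "r = (!) [X 0 $ 3, X 0 $ 1, X 0 $ 2, along T (\<lambda>q. X q $ 2) 0,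
    \<eta> 0, along T \<eta> 0, along S \<eta> 0, along F1 \<eta> 0]"
  have r: "r 0 = X 0 $ 3" "r (Suc 0) = X 0 $ 1" "r 2 = X 0 $ 2" "r 3 = along T (\<lambda>q. X q $ 2) 0"
    "r 4 = \<eta> 0" "r 5 = along T \<eta> 0" "r 6 = along S \<eta> 0" "r 7 = along F1 \<eta> 0"
    by (simp_all add: r_def numeral_eq_Suc)
  have \<eta>: "smooth \<eta>" using c by (simp add: conformal_factor_def)
  let ?Y = "\<lambda>q. X q + (- 1) *\<^sub>R generator_combination r q"
  let ?\<theta> = "\<lambda>q. \<eta> q + (- 1) * (r 4 + r 5 * q$1 + r 6 * q$2 + r 7 * q$3)"
  have "?Y = (\<lambda>q. 0)"
  proof (rule conformal_field_determined_by_jet)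
    show "smooth ?Y" using X by simp
    show "conformal_factor ?Y ?\<theta>"
      by (intro conformal_factor_add conformal_factor_scaleR X c smooth_generator_combination
          conformal_factor_generator_combination smooth_scaleR smooth_const)
    show "?Y 0 = 0" by (simp add: vec3_eq_iff generator_combination_def r)
    show "along T (\<lambda>q. ?Y q $ 2) 0 = 0"
      using X by (simp add: generator_combination_def r)
    show "?\<theta> 0 = 0" "along T ?\<theta> 0 = 0" "along S ?\<theta> 0 = 0" "along F1 ?\<theta> 0 = 0"
      using \<eta> by (simp_all add: r)
  qed
  then have "X = generator_combination r" by (simp add: fun_eq_iff)
  then show ?thesis by blast
qed

text \<open>Stated for lists, with a relation having one coefficient for each position: this excludes
repeated entries as well, so distinctness needs no comparison of the individual fields.\<close>

lemma distinct_independent_listI: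
  fixes vs :: "'a::real_vector list"
  assumes "\<And>r i. (\<Sum>i<length vs. r i *\<^sub>R vs ! i) = 0 \<Longrightarrow> i < length vs \<Longrightarrow> r i = 0"
  shows "distinct vs" "independent (set vs)"
proof -
  show d: "distinct vs"
    unfolding distinct_conv_nth
  proof (intro allI impI notI)
    fix i j assume ij: "i < length vs" "j < length vs" "i \<noteq> j" "vs ! i = vs ! j"
    let ?r = "\<lambda>k. if k = i then 1 else if k = j then - 1 else 0 :: real"
    have "(\<Sum>k<length vs. ?r k *\<^sub>R vs ! k) = (\<Sum>k\<in>{i, j}. ?r k *\<^sub>R vs ! k)"
      using ij by (intro sum.mono_neutral_right) auto
    also have "\<dots> = 0" using ij by simp
    finally have "?r i = 0" using ij(1) by (rule assms[of ?r i])
    then show False by simp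
  qed
  show "independent (set vs)"
    unfolding real_vector.dependent_finite[OF finite_set]
  proof (intro notI, elim exE conjE bexE)
    fix u v assume v: "v \<in> set vs" "u v \<noteq> 0" and s: "(\<Sum>v\<in>set vs. u v *\<^sub>R v) = 0"
    have "bij_betw ((!) vs) {..<length vs} (set vs)"
      using d by (rule bij_betw_nth) simp_all
    from sum.reindex_bij_betw[OF this, of "\<lambda>v. u v *\<^sub>R v"] s
    have "(\<Sum>i<length vs. u (vs ! i) *\<^sub>R vs ! i) = 0" by simp
    then have "i < length vs \<Longrightarrow> u (vs ! i) = 0" for i by (rule assms)
    with v show False by (auto simp: in_set_conv_nth)
  qed
qed

lemma generators_distinct_independent:
  "distinct [F1, F2, F3, F4, F5, F6, F7, F8]" "independent {F1, F2, F3, F4, F5, F6, F7, F8}"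
proof -
  have length: "length [F1, F2, F3, F4, F5, F6, F7, F8] = 8" by simp
  have *: "(\<Sum>i<length [F1, F2, F3, F4, F5, F6, F7, F8]. r i *\<^sub>R [F1, F2, F3, F4, F5, F6, F7, F8] ! i) = 0 \<Longrightarrow>
    i < length [F1, F2, F3, F4, F5, F6, F7, F8] \<Longrightarrow> r i = 0" for r :: "nat \<Rightarrow> real" and i
    unfolding length generator_combination_eq_sum[symmetric] by (rule generator_combination_eq_zeroD)
  show "distinct [F1, F2, F3, F4, F5, F6, F7, F8]"
    by (rule distinct_independent_listI(1)) (rule *)
  have "independent (set [F1, F2, F3, F4, F5, F6, F7, F8])"
    by (rule distinct_independent_listI(2)) (rule *)
  then show "independent {F1, F2, F3, F4, F5, F6, F7, F8}" by simp
qed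

lemma subspace_conf_H3: "subspace conf_H3"
proof (rule subspaceI)
  show "0 \<in> conf_H3"
    using conformal_factor_zero by (auto simp: conf_H3_def zero_fun_def)
next
  fix X Y assume "X \<in> conf_H3" "Y \<in> conf_H3"
  then show "X + Y \<in> conf_H3"
    using conformal_factor_add by (fastforce simp: conf_H3_def plus_fun_def)
next
  fix r X assume "X \<in> conf_H3"
  then show "r *\<^sub>R X \<in> conf_H3"
    using conformal_factor_scaleR by (fastforce simp: conf_H3_def scaleR_fun_def)
qed

lemma span_generators: "span {F1, F2, F3, F4, F5, F6, F7, F8} = conf_H3"
proof
  have "{F1, F2, F3, F4, F5, F6, F7, F8} \<subseteq> conf_H3"
    using conformal_factor_generators by (auto simp: conf_H3_def)
  then show "span {F1, F2, F3, F4, F5, F6, F7, F8} \<subseteq> conf_H3"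
    by (rule span_minimal[OF _ subspace_conf_H3])
  show "conf_H3 \<subseteq> span {F1, F2, F3, F4, F5, F6, F7, F8}"
  proof
    fix X assume "X \<in> conf_H3"
    then obtain r where r: "X = generator_combination r"
      using conformal_field_is_combination by (auto simp: conf_H3_def)
    have "[F1, F2, F3, F4, F5, F6, F7, F8] ! i \<in> {F1, F2, F3, F4, F5, F6, F7, F8}" if "i < 8" for i
      using nth_mem[of i "[F1, F2, F3, F4, F5, F6, F7, F8]"] that by simp
    then show "X \<in> span {F1, F2, F3, F4, F5, F6, F7, F8}"
      unfolding r generator_combination_eq_sum by (intro span_sum span_scale span_base) auto
  qed
qed

theorem corollary7p6:
  shows "lie_algebra_of_fields conf_H3 \<and> dim conf_H3 = 8 \<and>
    distinct [F1, F2, F3, F4, F5, F6, F7, F8] \<and>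
    independent {F1, F2, F3, F4, F5, F6, F7, F8} \<and>
    span {F1, F2, F3, F4, F5, F6, F7, F8} = conf_H3 \<and>
    (\<forall>X \<in> {F1, F2, F3, F4}. \<forall>\<eta>. conformal_factor X \<eta> \<longleftrightarrow> \<eta> = (\<lambda>q. 0)) \<and>
    (\<exists>c. c \<noteq> 0 \<and> (\<forall>\<eta>. conformal_factor F5 \<eta> \<longleftrightarrow> \<eta> = (\<lambda>q. c))) \<and>
    (\<exists>c. c \<noteq> 0 \<and> (\<forall>\<eta>. conformal_factor F6 \<eta> \<longleftrightarrow> \<eta> = (\<lambda>q. c * q$1))) \<and>
    (\<exists>c. c \<noteq> 0 \<and> (\<forall>\<eta>. conformal_factor F7 \<eta> \<longleftrightarrow> \<eta> = (\<lambda>q. c * q$2))) \<and>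
    (\<exists>c. c \<noteq> 0 \<and> (\<forall>\<eta>. conformal_factor F8 \<eta> \<longleftrightarrow> \<eta> = (\<lambda>q. c * q$3)))"
proof (intro conjI)
  show "lie_algebra_of_fields conf_H3"
    unfolding lie_algebra_of_fields_def
    using subspace_conf_H3 conformal_factor_lie_bracket by (fastforce simp: conf_H3_def)
  have "dim conf_H3 = card (set [F1, F2, F3, F4, F5, F6, F7, F8])"
    using dim_eq_card_independent[OF generators_distinct_independent(2)]
    by (simp add: dim_span flip: span_generators)
  also have "\<dots> = 8"
    using distinct_card[OF generators_distinct_independent(1)] by simp
  finally show "dim conf_H3 = 8" .
  show "\<forall>X \<in> {F1, F2, F3, F4}. \<forall>\<eta>. conformal_factor X \<eta> \<longleftrightarrow> \<eta> = (\<lambda>q. 0)"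
    using conformal_factor_generators by (auto simp: conformal_factor_iff_eq)
  show "\<exists>c. c \<noteq> 0 \<and> (\<forall>\<eta>. conformal_factor F5 \<eta> \<longleftrightarrow> \<eta> = (\<lambda>q. c))"
    using conformal_factor_generators(5) by (intro exI[of _ 1]) (simp add: conformal_factor_iff_eq)
  show "\<exists>c. c \<noteq> 0 \<and> (\<forall>\<eta>. conformal_factor F6 \<eta> \<longleftrightarrow> \<eta> = (\<lambda>q. c * q$1))"
    using conformal_factor_generators(6) by (intro exI[of _ 1]) (simp add: conformal_factor_iff_eq)
  show "\<exists>c. c \<noteq> 0 \<and> (\<forall>\<eta>. conformal_factor F7 \<eta> \<longleftrightarrow> \<eta> = (\<lambda>q. c * q$2))"
    using conformal_factor_generators(7) by (intro exI[of _ 1]) (simp add: conformal_factor_iff_eq)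
  show "\<exists>c. c \<noteq> 0 \<and> (\<forall>\<eta>. conformal_factor F8 \<eta> \<longleftrightarrow> \<eta> = (\<lambda>q. c * q$3))"
    using conformal_factor_generators(8) by (intro exI[of _ 1]) (simp add: conformal_factor_iff_eq)
qed (fact generators_distinct_independent span_generators)+

end
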